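(* Let $q$ be a prime power, let $n \geq 4$ and let $0 \leq h \leq n$ be integers. Then $$\frac{1}{q^{h+n}} \sum_{A \in \mathcal{M}_n } \sum_{B \in \mathcal{A}_{<h} } d (A)\, d (A+B) = (n+1)^2 + \frac{1}{q^{2h+n}} \sum_{A \in \mathcal{M}_n} \lvert \Delta (A;h) \rvert^2 ,$$ and this quantity equals $$\begin{cases} (n+1)^2 + (1 - q^{-1})\, q^{-h}\, \dfrac{(n-2h-1) (n-2h) (n-2h+1)}{6} & \text{if } h \leq \lfloor \frac{n}{2} \rfloor - 1 , \\ (n+1)^2 & \text{if } h \geq \lfloor \frac{n}{2} \rfloor . \end{cases}$$
   Context: $\mathcal{A} = \mathbb{F}_q[T]$; $\mathcal{M}$ is the set of monic polynomials in $\mathcal{A}$ and $\mathcal{M}_n$ the set of those of degree $n$. Convention: $\deg 0 = -\infty$; $\mathcal{A}_{<h}$ is the set of polynomials in $\mathcal{A}$ of degree less than $h$, including the zero polynomial (so it has $q^h$ elements). For $N \in \mathcal{M}$, $d(N)$ is the number of pairs $(A_1,A_2) \in \mathcal{M}^2$ with $A_1A_2 = N$. For $A \in \mathcal{M}_n$ and $0 \leq h \leq n$, let $I(A;h) := \{ B \in \mathcal{M} : \deg (B-A) < h \}$ and $$\Delta (A;h) := \sum_{B \in I(A;h)} d(B) \; - \; q^h (n+1).$$ *)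

theory Defs
  imports Complex_Main "HOL-Computational_Algebra.Polynomial" "HOL-Library.Cardinality"
begin

definition monic_polys :: "nat \<Rightarrow> 'a::field poly set" where
  "monic_polys n = {A. lead_coeff A = 1 \<and> degree A = n}"

text \<open>
  The library has \<open>degree 0 = 0\<close>, whereas here the zero polynomial has degree
  \<open>-\<infinity>\<close>; hence \<open>0\<close> is admitted for every \<open>h\<close>, including \<open>h = 0\<close>.
\<close>
definition polys_below :: "nat \<Rightarrow> 'a::field poly set" where
  "polys_below h = {B. B = 0 \<or> degree B < h}"

definition divisor_count :: "'a::field poly \<Rightarrow> nat" where
  "divisor_count N = card {(A1, A2). lead_coeff A1 = 1 \<and> lead_coeff A2 = 1 \<and> A1 * A2 = N}"

definition short_interval :: "'a::field poly \<Rightarrow> nat \<Rightarrow> 'a poly set" where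
  "short_interval A h = {B. lead_coeff B = 1 \<and> B - A \<in> polys_below h}"

text \<open>Used for monic \<open>A\<close> of degree \<open>n\<close> and \<open>h \<le> n\<close>; here \<open>CARD('a)\<close> is the order \<open>q\<close> of the field.\<close>
definition divisor_error :: "'a::{field,finite} poly \<Rightarrow> nat \<Rightarrow> real" where
  "divisor_error A h =
     (\<Sum>B\<in>short_interval A h. real (divisor_count B)) - real CARD('a) ^ h * (real (degree A) + 1)"

end

theory Submission
  imports Defs
begin

text \<open>
  Write \<open>q\<close> for the order of the field. Expanding both divisor functions, the correlation sum
  counts the quadruples of monic polynomials \<open>a\<close>, \<open>b\<close>, \<open>c\<close>, \<open>d\<close> such that \<open>a * b\<close> and \<open>c * d\<close> have
  degree \<open>n\<close> and differ by a polynomial of degree less than \<open>h\<close>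
  (\<open>divisor_correlation_eq_count\<close>). Sort them by \<open>j = degree a\<close> and \<open>k = degree c\<close>, and suppose
  first that \<open>j + k \<le> n\<close>.

  Fix \<open>a\<close> and \<open>c\<close>, and let \<open>i\<close> be the degree of their gcd \<open>g\<close>. The pairs \<open>(b, d)\<close> for which
  \<open>a * b - c * d\<close> has degree below \<open>h\<close> form a translate of the solutions of a linear problem:
  \<open>a * b - c * d\<close> may be any multiple of \<open>g\<close> of degree below \<open>h\<close>, and once it is prescribed the
  pair is determined up to a multiple of \<open>(c div g, a div g)\<close>. Hence there are
  \<open>q ^ (n - j - k + max h i)\<close> such pairs (\<open>card_monic_near_solutions\<close>), a number that depends on
  \<open>a\<close> and \<open>c\<close> only through their degrees and \<open>i\<close>. The number of pairs \<open>(a, c)\<close> with gcd of degree \<open>i\<close> is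
  \<open>(1 - 1 / q) * q ^ (j + k - i)\<close> for \<open>i < min j k\<close>, and \<open>q ^ (j + k - i)\<close> for \<open>i = min j k\<close>
  (\<open>card_coprime_pairs\<close>). In the sum over \<open>i\<close> the terms with \<open>i < h\<close> telescope into the main term
  \<open>q ^ (n + h)\<close>, and each \<open>i\<close> with \<open>h \<le> i < min j k\<close> adds \<open>(1 - 1 / q) * q ^ n\<close>. Exchanging the two
  factors of each product reduces \<open>j + k > n\<close> to this case, so that in general the excess over the
  main term is proportional to the positive part of \<open>min {j, k, n - j, n - k} - h\<close>
  (\<open>card_near_quadruples\<close>). The main terms add up to \<open>(n + 1)\<^sup>2 * q ^ (n + h)\<close>, and the excesses
  to the cubic polynomial (\<open>sum_min_excess\<close>).

  The identity with the variance is formal. The sum of the divisor function over the interval around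
  \<open>A\<close> is unchanged when \<open>A\<close> moves within the interval, so its second moment is \<open>q ^ h\<close> times the
  correlation sum, while its mean is \<open>q ^ h * (n + 1)\<close> (\<open>sum_divisor_error_square\<close>).
\<close>

section \<open>Polynomials of bounded degree and monic polynomials\<close>

text \<open>
  In terms of coefficients the zero polynomial is no exception, which makes the closure
  properties below immediate.
\<close>
lemma polys_below_iff_coeff: "B \<in> polys_below h \<longleftrightarrow> (\<forall>i\<ge>h. coeff B i = 0)"
proof
  assume "B \<in> polys_below h"
  then show "\<forall>i\<ge>h. coeff B i = 0"
    by (auto simp: polys_below_def intro: coeff_eq_0)
next
  assume *: "\<forall>i\<ge>h. coeff B i = 0"
  show "B \<in> polys_below h"
  proof (cases "B = 0")
    case False
    then have "\<not> h \<le> degree B"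
      using * by (metis leading_coeff_0_iff)
    then show ?thesis by (simp add: polys_below_def)
  qed (simp add: polys_below_def)
qed

lemma polys_below_0 [simp]: "polys_below 0 = {0}"
  by (auto simp: polys_below_def)

lemma polys_below_add: "B \<in> polys_below h \<Longrightarrow> C \<in> polys_below h \<Longrightarrow> B + C \<in> polys_below h"
  by (simp add: polys_below_iff_coeff)

lemma polys_below_diff: "B \<in> polys_below h \<Longrightarrow> C \<in> polys_below h \<Longrightarrow> B - C \<in> polys_below h"
  by (simp add: polys_below_iff_coeff)

lemma polys_below_uminus_iff [simp]: "- B \<in> polys_below h \<longleftrightarrow> B \<in> polys_below h"
  by (simp add: polys_below_iff_coeff)

lemma polys_below_mono: "B \<in> polys_below h \<Longrightarrow> h \<le> k \<Longrightarrow> B \<in> polys_below k"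
  by (simp add: polys_below_iff_coeff)

lemma monic_polys_iff_coeff: "A \<in> monic_polys n \<longleftrightarrow> coeff A n = 1 \<and> (\<forall>i>n. coeff A i = 0)"
proof
  assume "A \<in> monic_polys n"
  then show "coeff A n = 1 \<and> (\<forall>i>n. coeff A i = 0)"
    by (auto simp: monic_polys_def intro: coeff_eq_0)
next
  assume *: "coeff A n = 1 \<and> (\<forall>i>n. coeff A i = 0)"
  then have "degree A = n"
    by (intro antisym degree_le le_degree) auto
  then show "A \<in> monic_polys n" using * by (simp add: monic_polys_def)
qed

lemma monic_polys_nonzero: "A \<in> monic_polys n \<Longrightarrow> A \<noteq> 0"
  by (auto simp: monic_polys_def)

lemma monic_polys_degree: "A \<in> monic_polys n \<Longrightarrow> degree A = n"
  by (simp add: monic_polys_def)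

lemma monom_in_monic_polys: "monom 1 n \<in> monic_polys n"
  by (simp add: monic_polys_iff_coeff)

lemma monic_polys_add_below:
  "A \<in> monic_polys n \<Longrightarrow> B \<in> polys_below n \<Longrightarrow> A + B \<in> monic_polys n"
  by (simp add: monic_polys_iff_coeff polys_below_iff_coeff)

lemma monic_polys_diff_below:
  "A \<in> monic_polys n \<Longrightarrow> B \<in> polys_below n \<Longrightarrow> A - B \<in> monic_polys n"
  by (simp add: monic_polys_iff_coeff polys_below_iff_coeff)

lemma monic_polys_diff:
  "A \<in> monic_polys n \<Longrightarrow> B \<in> monic_polys n \<Longrightarrow> A - B \<in> polys_below n"
  by (auto simp: monic_polys_iff_coeff polys_below_iff_coeff order_le_less)

lemma monic_polys_mult:
  "A \<in> monic_polys m \<Longrightarrow> B \<in> monic_polys n \<Longrightarrow> A * B \<in> monic_polys (m + n)"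
  using lead_coeff_mult[of A B] degree_mult_eq[of A B] monic_polys_nonzero[of A m] monic_polys_nonzero[of B n]
  by (auto simp: monic_polys_def)

lemma monic_polys_cancel_left:
  assumes "A \<in> monic_polys m" "A * B \<in> monic_polys n"
  shows "m \<le> n" and "B \<in> monic_polys (n - m)"
proof -
  have "A \<noteq> 0" "B \<noteq> 0" using assms by (auto simp: monic_polys_def)
  then have "degree (A * B) = degree A + degree B" by (rule degree_mult_eq)
  moreover have "lead_coeff (A * B) = lead_coeff A * lead_coeff B" by (rule lead_coeff_mult)
  ultimately show "m \<le> n" "B \<in> monic_polys (n - m)"
    using assms by (auto simp: monic_polys_def)
qed

text \<open>
  The truncated subtraction is what the zero polynomial requires: for \<open>h \<le> m\<close> the only
  multiple of \<open>A\<close> of degree below \<open>h\<close> is \<open>0\<close>, and \<open>polys_below 0 = {0}\<close>.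
\<close>
lemma monic_mult_in_polys_below_iff:
  assumes "A \<in> monic_polys m"
  shows "A * B \<in> polys_below h \<longleftrightarrow> B \<in> polys_below (h - m)"
  using monic_polys_nonzero[OF assms] monic_polys_degree[OF assms] degree_mult_eq[of A B]
  by (cases "B = 0") (auto simp: polys_below_def)

lemma finite_and_card_polys_below:
  "finite (polys_below h :: 'a::{field,finite} poly set)
   \<and> card (polys_below h :: 'a poly set) = CARD('a) ^ h"
proof (induction h)
  case 0
  then show ?case by simp
next
  case (Suc h)
  have inj: "inj_on (\<lambda>(c, B). pCons c B) (UNIV \<times> polys_below h :: ('a \<times> 'a poly) set)"
    by (auto simp: inj_on_def)
  have "(polys_below (Suc h) :: 'a poly set) = (\<lambda>(c, B). pCons c B) ` (UNIV \<times> polys_below h)"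
  proof (intro equalityI subsetI)
    fix B :: "'a poly" assume B: "B \<in> polys_below (Suc h)"
    obtain c C where C: "B = pCons c C" by (cases B)
    have "C \<in> polys_below h"
      unfolding polys_below_iff_coeff
    proof (intro allI impI)
      fix i assume "h \<le> i"
      then have "coeff B (Suc i) = 0" using B by (simp add: polys_below_iff_coeff)
      then show "coeff C i = 0" by (simp add: C)
    qed
    then show "B \<in> (\<lambda>(c, B). pCons c B) ` (UNIV \<times> polys_below h)" using C by auto
  next
    fix B :: "'a poly" assume "B \<in> (\<lambda>(c, B). pCons c B) ` (UNIV \<times> polys_below h)"
    then show "B \<in> polys_below (Suc h)"
      by (auto simp: polys_below_iff_coeff coeff_pCons split: nat.split)
  qed
  then show ?case
    using Suc inj by (simp add: card_image card_cartesian_product)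
qed

lemma finite_polys_below [simp]: "finite (polys_below h :: 'a::{field,finite} poly set)"
  and card_polys_below: "card (polys_below h :: 'a::{field,finite} poly set) = CARD('a) ^ h"
  using finite_and_card_polys_below by auto

lemma monic_polys_eq_image: "A \<in> monic_polys n \<Longrightarrow> monic_polys n = (+) A ` polys_below n"
  using monic_polys_diff[of _ n A]
  by (auto intro!: monic_polys_add_below image_eqI[of _ _ "_ - A"])

lemma finite_monic_polys [simp]: "finite (monic_polys n :: 'a::{field,finite} poly set)"
  and card_monic_polys: "card (monic_polys n :: 'a::{field,finite} poly set) = CARD('a) ^ n"
  using monic_polys_eq_image[OF monom_in_monic_polys[of n, where 'a = 'a]]
  by (simp_all add: card_image card_polys_below)

section \<open>Greatest common divisors and coprime pairs\<close>

text \<open>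
  The monic generator \<open>g\<close> of the ideal spanned by \<open>a\<close> and \<open>c\<close> is obtained as a nonzero element of
  least degree; cancelling \<open>g\<close> from its own representation gives the Bezout identity for the
  cofactors.
\<close>
lemma monic_bezout:
  fixes a c :: "'a::field poly"
  assumes "a \<noteq> 0"
  obtains g a' c' u v where "lead_coeff g = 1" "a = g * a'" "c = g * c'" "u * a' + v * c' = 1"
proof -
  define I where "I = {x. x \<noteq> 0 \<and> (\<exists>u v. x = u * a + v * c)}"
  have "a \<in> I"
    using assms unfolding I_def by (simp, metis add_0_right mult_1 mult_zero_left)
  then obtain x where x: "x \<in> I" and x_min: "\<And>y. y \<in> I \<Longrightarrow> degree x \<le> degree y"
    using ex_has_least_nat[of "\<lambda>x. x \<in> I" a degree] by blast
  define g where "g = smult (inverse (lead_coeff x)) x"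
  from x obtain u v where xuv: "x \<noteq> 0" "x = u * a + v * c" by (auto simp: I_def)
  define u' v' where "u' = smult (inverse (lead_coeff x)) u" and "v' = smult (inverse (lead_coeff x)) v"
  have g: "lead_coeff g = 1" "degree g = degree x" "g \<noteq> 0"
    using xuv(1) by (simp_all add: g_def)
  have g_comb: "g = u' * a + v' * c"
    unfolding g_def u'_def v'_def by (subst (2) xuv(2)) (simp add: smult_add_right)
  have dvd: "g dvd u * a + v * c" for u v
  proof (rule ccontr)
    let ?y = "u * a + v * c"
    assume "\<not> g dvd ?y"
    then have nz: "?y mod g \<noteq> 0" by (simp add: dvd_eq_mod_eq_0)
    define t where "t = ?y div g"
    have "?y mod g = ?y - t * g" unfolding t_def by (rule minus_div_mult_eq_mod[symmetric])
    also have "\<dots> = (u - t * u') * a + (v - t * v') * c"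
      unfolding g_comb by (simp add: algebra_simps)
    finally have "?y mod g \<in> I" using nz unfolding I_def by blast
    then show False
      using x_min degree_mod_less'[OF g(3) nz] g(2) by fastforce
  qed
  from dvd[of 1 0] dvd[of 0 1] obtain a' c' where ac: "a = g * a'" "c = g * c'"
    by (auto elim!: dvdE)
  have "g * (u' * a' + v' * c') = g * 1"
    using g_comb ac by (simp add: algebra_simps)
  then have "u' * a' + v' * c' = 1" using g(3) by (simp only: mult_cancel_left) simp
  then show ?thesis using that g(1) ac by blast
qed

text \<open>
  Coprimality is encoded by a Bezout identity, the form in which it is both obtained and used.
\<close>
definition coprime_pairs :: "nat \<Rightarrow> nat \<Rightarrow> ('a::field poly \<times> 'a poly) set" where
  "coprime_pairs j k = {(a, c) \<in> monic_polys j \<times> monic_polys k. \<exists>u v. u * a + v * c = 1}"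

lemma finite_coprime_pairs [simp]: "finite (coprime_pairs j k :: ('a::{field,finite} poly \<times> 'a poly) set)"
  by (rule finite_subset[of _ "monic_polys j \<times> monic_polys k"]) (auto simp: coprime_pairs_def)

lemma monic_factor_unique:
  fixes g1 g2 :: "'a::field poly"
  assumes "g1 \<in> monic_polys i1" "g2 \<in> monic_polys i2"
    and "(a1, c1) \<in> coprime_pairs j1 k1" "(a2, c2) \<in> coprime_pairs j2 k2"
    and eq: "g1 * a1 = g2 * a2" "g1 * c1 = g2 * c2"
  shows "g1 = g2"
proof -
  have dvd: "x dvd y" if "x * a = y * b" "x * c = y * d" "u * b + v * d = 1" for x y a b c d u v :: "'a poly"
  proof -
    have "y = y * (u * b + v * d)" using that by simp
    also have "\<dots> = x * (u * a + v * c)"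
      using that(1,2) by (simp add: algebra_simps) (metis mult.left_commute)
    finally show ?thesis by (metis dvd_triv_left)
  qed
  have "g1 dvd g2"
    using assms(4) dvd[OF eq] by (auto simp: coprime_pairs_def)
  have "g2 dvd g1"
    using assms(3) dvd[OF eq[symmetric]] by (auto simp: coprime_pairs_def)
  obtain r where r: "g2 = g1 * r" using \<open>g1 dvd g2\<close> by (rule dvdE)
  have "i1 \<le> i2" "r \<in> monic_polys (i2 - i1)"
    using monic_polys_cancel_left assms(1,2) r by blast+
  moreover have "i2 \<le> i1"
    using dvd_imp_degree_le[OF \<open>g2 dvd g1\<close>] monic_polys_nonzero[OF assms(1)] assms(1,2)
    by (simp add: monic_polys_degree)
  ultimately have "r \<in> monic_polys 0" by simp
  then have "r = 1"
    by (auto simp: monic_polys_def elim!: degree_eq_zeroE)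
  then show ?thesis using r by simp
qed

text \<open>
  Every pair of monic polynomials is uniquely a monic gcd times a coprime monic pair; sums over
  pairs whose terms depend only on the degree of the gcd therefore become sums over that degree.
\<close>
lemma bij_betw_extract_gcd:
  "bij_betw (\<lambda>(i, g, a, c). (g * a, g * c))
     (SIGMA i:{..min j k}. monic_polys i \<times> coprime_pairs (j - i) (k - i))
     (monic_polys j \<times> monic_polys k :: ('a::field poly \<times> 'a poly) set)"
proof (rule bij_betw_imageI)
  show "inj_on (\<lambda>(i, g, a, c). (g * a, g * c))
     (SIGMA i:{..min j k}. (monic_polys i :: 'a poly set) \<times> (coprime_pairs (j - i) (k - i) :: ('a poly \<times> 'a poly) set))"
  proof (rule inj_onI, clarify)
    fix i1 i2 and g1 a1 c1 g2 a2 c2 :: "'a poly"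
    assume 1: "g1 \<in> monic_polys i1" "g2 \<in> monic_polys i2"
      "(a1, c1) \<in> coprime_pairs (j - i1) (k - i1)" "(a2, c2) \<in> coprime_pairs (j - i2) (k - i2)"
      "g1 * a1 = g2 * a2" "g1 * c1 = g2 * c2"
    then have "g1 = g2" by (rule monic_factor_unique)
    with 1 show "i1 = i2 \<and> (g1, a1, c1) = (g2, a2, c2)" by (auto simp: monic_polys_def)
  qed
next
  show "(\<lambda>(i, g, a, c). (g * a, g * c)) `
     (SIGMA i:{..min j k}. monic_polys i \<times> coprime_pairs (j - i) (k - i))
     = (monic_polys j \<times> monic_polys k :: ('a::field poly \<times> 'a poly) set)" (is "?L = ?R")
  proof (intro equalityI subsetI)
    fix x :: "'a poly \<times> 'a poly" assume "x \<in> ?L"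
    then obtain i g a c where x: "x = (g * a, g * c)" "i \<le> min j k" "g \<in> monic_polys i"
      "a \<in> monic_polys (j - i)" "c \<in> monic_polys (k - i)"
      by (auto simp: coprime_pairs_def)
    then show "x \<in> ?R"
      using monic_polys_mult[OF x(3,4)] monic_polys_mult[OF x(3,5)] by simp
  next
    fix x :: "'a poly \<times> 'a poly" assume "x \<in> ?R"
    then obtain a c where x: "x = (a, c)" "a \<in> monic_polys j" "c \<in> monic_polys k" by auto
    then obtain g a' c' u v where g: "lead_coeff g = 1" "a = g * a'" "c = g * c'" "u * a' + v * c' = 1"
      using monic_bezout[of a c] monic_polys_nonzero by metis
    define i where "i = degree g"
    have gi: "g \<in> monic_polys i" using g(1) by (simp add: i_def monic_polys_def)
    have "i \<le> min j k" "(a', c') \<in> coprime_pairs (j - i) (k - i)"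
      using monic_polys_cancel_left[OF gi] x g(2-4) by (auto simp: coprime_pairs_def)
    then show "x \<in> ?L"
      using gi x(1) g(2,3) by (intro image_eqI[of _ _ "(i, g, a', c')"]) auto
  qed
qed

lemma sum_monic_pairs_by_gcd:
  fixes F :: "'a::{field,finite} poly \<Rightarrow> 'a poly \<Rightarrow> real"
  assumes "\<And>i g a c. i \<le> min j k \<Longrightarrow> g \<in> monic_polys i \<Longrightarrow> (a, c) \<in> coprime_pairs (j - i) (k - i)
             \<Longrightarrow> F (g * a) (g * c) = f i"
  shows "(\<Sum>a\<in>monic_polys j. \<Sum>c\<in>monic_polys k. F a c)
    = (\<Sum>i\<le>min j k. real CARD('a) ^ i
         * real (card (coprime_pairs (j - i) (k - i) :: ('a poly \<times> 'a poly) set)) * f i)"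
proof -
  have "(\<Sum>a\<in>monic_polys j. \<Sum>c\<in>monic_polys k. F a c)
      = (\<Sum>(a, c)\<in>monic_polys j \<times> monic_polys k. F a c)"
    by (rule sum.cartesian_product)
  also have "\<dots> = (\<Sum>x\<in>(SIGMA i:{..min j k}. monic_polys i \<times> coprime_pairs (j - i) (k - i)).
                  case (\<lambda>(i, g, a, c). (g * a, g * c)) x of (a, c) \<Rightarrow> F a c)"
    by (rule sum.reindex_bij_betw[OF bij_betw_extract_gcd, symmetric])
  also have "\<dots> = (\<Sum>x\<in>(SIGMA i:{..min j k}. (monic_polys i :: 'a poly set) \<times> (coprime_pairs (j - i) (k - i) :: ('a poly \<times> 'a poly) set)).
                  f (fst x))"
    by (rule sum.cong) (auto intro!: assms)
  also have "\<dots> = (\<Sum>i\<le>min j k. \<Sum>y\<in>(monic_polys i :: 'a poly set) \<times> (coprime_pairs (j - i) (k - i) :: ('a poly \<times> 'a poly) set). f i)"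
    by (subst sum.Sigma) (auto intro!: sum.cong)
  also have "\<dots> = (\<Sum>i\<le>min j k. real CARD('a) ^ i
         * real (card (coprime_pairs (j - i) (k - i) :: ('a poly \<times> 'a poly) set)) * f i)"
    by (simp add: card_cartesian_product card_monic_polys)
  finally show ?thesis .
qed

text \<open>
  Sorting all \<open>q ^ (j + k)\<close> monic pairs by the degree of their gcd, the terms with nontrivial gcd
  are \<open>q\<close> times the same decomposition for degrees \<open>j - 1\<close> and \<open>k - 1\<close>, hence add up to
  \<open>q * q ^ (j + k - 2)\<close>. What is left is the number of coprime pairs.
\<close>
lemma card_coprime_pairs:
  "real (card (coprime_pairs j k :: ('a::{field,finite} poly \<times> 'a poly) set))
   = (if min j k = 0 then 1 else 1 - 1 / real CARD('a)) * real CARD('a) ^ (j + k)"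
proof -
  let ?q = "real CARD('a)"
  let ?C = "\<lambda>j k. real (card (coprime_pairs j k :: ('a poly \<times> 'a poly) set))"
  have total: "(\<Sum>i\<le>min j k. ?q ^ i * ?C (j - i) (k - i)) = ?q ^ (j + k)" for j k
    using sum_monic_pairs_by_gcd[of j k "\<lambda>(_::'a poly) _. 1" "\<lambda>_. 1"]
    by (simp add: card_monic_polys power_add)
  show ?thesis
  proof (cases "min j k = 0")
    case True
    with total[of j k] show ?thesis by simp
  next
    case False
    then obtain j' k' where jk: "j = Suc j'" "k = Suc k'"
      by (cases j; cases k) auto
    have "?q ^ (j + k) = (\<Sum>i\<le>Suc (min j' k'). ?q ^ i * ?C (j - i) (k - i))"
      using total[of j k] by (simp add: jk)
    also have "\<dots> = ?C j k + (\<Sum>i\<le>min j' k'. ?q ^ Suc i * ?C (j' - i) (k' - i))"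
      by (subst sum.atMost_Suc_shift) (simp add: jk)
    also have "(\<Sum>i\<le>min j' k'. ?q ^ Suc i * ?C (j' - i) (k' - i)) = ?q * ?q ^ (j' + k')"
      unfolding total[symmetric] sum_distrib_left by (simp add: mult.assoc)
    finally show ?thesis using False by (simp add: jk field_simps)
  qed
qed

section \<open>Nearly equal products\<close>

text \<open>
  The map \<open>(x, y) \<mapsto> a * x - c * y\<close> sends the solutions onto the polynomials of degree below
  \<open>h - i\<close>, because \<open>g\<close> has degree \<open>i\<close> and divides the left-hand side of the condition. Its kernel
  consists of the multiples of \<open>(c, a)\<close>, and adding \<open>t\<close> times \<open>(c, a)\<close> adds \<open>t\<close> to \<open>x div c\<close>. So the
  quotient \<open>x div c\<close> and the value \<open>a * x - c * y\<close> are independent coordinates for the solutions.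
\<close>
lemma card_homogeneous_near_solutions:
  fixes g a c :: "'a::{field,finite} poly"
  assumes g: "g \<in> monic_polys i" and ac: "(a, c) \<in> coprime_pairs \<alpha> \<beta>"
    and deg: "\<alpha> + N = \<beta> + L" "\<beta> \<le> N" "h \<le> i + \<alpha> + N"
  shows "card {(x, y) \<in> polys_below N \<times> polys_below L. g * a * x - g * c * y \<in> polys_below h}
         = CARD('a) ^ (N - \<beta> + (h - i))"
proof -
  define W where
    "W = {(x, y) \<in> polys_below N \<times> polys_below L. g * a * x - g * c * y \<in> polys_below h}"
  define \<phi> where "\<phi> = (\<lambda>(x, y). (x div c, a * x - c * y))"
  from ac obtain u v where a: "a \<in> monic_polys \<alpha>" and c: "c \<in> monic_polys \<beta>"
    and uv: "u * a + v * c = 1" by (auto simp: coprime_pairs_def)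
  have c0: "c \<noteq> 0" using c by (rule monic_polys_nonzero)
  have W_iff: "(x, y) \<in> W \<longleftrightarrow>
      x \<in> polys_below N \<and> y \<in> polys_below L \<and> a * x - c * y \<in> polys_below (h - i)" for x y
  proof -
    have "g * a * x - g * c * y = g * (a * x - c * y)" by (simp add: algebra_simps)
    then show ?thesis
      by (simp add: W_def monic_mult_in_polys_below_iff[OF g])
  qed
  have mod_below: "x mod c \<in> polys_below \<beta>" for x
    using degree_mod_less[OF c0, of x] c by (auto simp: polys_below_def monic_polys_degree)
  have "bij_betw \<phi> W (polys_below (N - \<beta>) \<times> polys_below (h - i))"
  proof (rule bij_betw_imageI)
    show "inj_on \<phi> W"
    proof (rule inj_onI, clarify)
      fix x1 y1 x2 y2 assume "\<phi> (x1, y1) = \<phi> (x2, y2)"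
      then have div: "x1 div c = x2 div c" and eq: "a * x1 - c * y1 = a * x2 - c * y2"
        by (auto simp: \<phi>_def)
      have "x1 - x2 = (u * a + v * c) * (x1 - x2)" using uv by simp
      also have "\<dots> = u * (a * x1 - a * x2) + c * (v * (x1 - x2))" by (simp add: algebra_simps)
      also have "a * x1 - a * x2 = c * (y1 - y2)" using eq by (simp add: algebra_simps)
      also have "u * (c * (y1 - y2)) + c * (v * (x1 - x2)) = c * (u * (y1 - y2) + v * (x1 - x2))"
        by (simp add: algebra_simps)
      finally have "c dvd x1 - x2" by (metis dvd_triv_left)
      then have "x1 mod c = x2 mod c" by (simp add: mod_eq_dvd_iff)
      with div have "x1 = x2" by (metis div_mult_mod_eq)
      with eq c0 show "x1 = x2 \<and> y1 = y2" by simp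
    qed
    show "\<phi> ` W = polys_below (N - \<beta>) \<times> polys_below (h - i)"
    proof (intro equalityI subsetI)
      fix z assume "z \<in> \<phi> ` W"
      then obtain x y where xy: "(x, y) \<in> W" "z = (x div c, a * x - c * y)" by (auto simp: \<phi>_def)
      have "c * (x div c) = x - x mod c" by (rule minus_mod_eq_mult_div[symmetric])
      moreover have "x - x mod c \<in> polys_below N"
        using xy(1) mod_below deg(2) W_iff polys_below_diff polys_below_mono by blast
      ultimately have "x div c \<in> polys_below (N - \<beta>)"
        by (simp flip: monic_mult_in_polys_below_iff[OF c])
      with xy W_iff show "z \<in> polys_below (N - \<beta>) \<times> polys_below (h - i)" by auto
    next
      fix z :: "'a poly \<times> 'a poly" assume "z \<in> polys_below (N - \<beta>) \<times> polys_below (h - i)"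
      then obtain t e where z: "z = (t, e)" "t \<in> polys_below (N - \<beta>)" "e \<in> polys_below (h - i)" by auto
      define r where "r = u * e mod c"
      define x where "x = c * t + r"
      have r: "r \<in> polys_below \<beta>" unfolding r_def by (rule mod_below)
      have "c * t \<in> polys_below N" using z(2) by (simp add: monic_mult_in_polys_below_iff[OF c])
      then have xN: "x \<in> polys_below N"
        unfolding x_def using r deg(2) polys_below_add polys_below_mono by blast
      \<comment> \<open>\<open>x\<close> was chosen so that \<open>a * x \<equiv> a * u * e \<equiv> e\<close> modulo \<open>c\<close>; this yields \<open>y\<close>.\<close>
      define w where "w = u * e div c"
      have "r = u * e - c * w" unfolding r_def w_def by (rule minus_mult_div_eq_mod[symmetric])
      then have "a * x - e = (u * a - 1) * e + c * (a * t - a * w)"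
        by (simp only: x_def) (simp add: algebra_simps)
      also have "u * a - 1 = - (v * c)" using uv by (simp add: algebra_simps add_eq_0_iff)
      also have "- (v * c) * e + c * (a * t - a * w) = c * (a * t - a * w - v * e)"
        by (simp add: algebra_simps)
      finally obtain y where y: "a * x - e = c * y" by blast
      have "a * x \<in> polys_below (\<alpha> + N)" using xN by (simp add: monic_mult_in_polys_below_iff[OF a])
      moreover have "e \<in> polys_below (\<alpha> + N)"
        by (rule polys_below_mono[OF z(3)]) (use deg(3) in simp)
      ultimately have "c * y \<in> polys_below (\<beta> + L)"
        unfolding y[symmetric] deg(1)[symmetric] by (rule polys_below_diff)
      then have "y \<in> polys_below L" by (simp add: monic_mult_in_polys_below_iff[OF c])
      moreover have e: "a * x - c * y = e" by (simp flip: y)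
      ultimately have "(x, y) \<in> W" using xN z(3) by (simp add: W_iff)
      moreover have "x div c = t"
        using r c0 c by (cases "r = 0")
          (auto simp: x_def div_poly_less polys_below_def monic_polys_degree)
      then have "\<phi> (x, y) = z" using z(1) e by (simp add: \<phi>_def)
      ultimately show "z \<in> \<phi> ` W" by (metis image_eqI)
    qed
  qed
  then have "card W = card (polys_below (N - \<beta>) \<times> polys_below (h - i) :: ('a poly \<times> 'a poly) set)"
    by (rule bij_betw_same_card)
  then show ?thesis
    by (simp add: W_def card_cartesian_product card_polys_below power_add)
qed

text \<open>
  The equation \<open>a * b = c * d\<close> has a monic solution of the right degrees, namely a multiple of
  \<open>(c, a)\<close>, and the difference of two monic solutions is a homogeneous one. This
  is where \<open>\<beta> \<le> N\<close> is needed: otherwise no monic \<open>b\<close> of degree \<open>N\<close> would be a multiple of \<open>c\<close>.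
\<close>
lemma card_monic_near_solutions:
  fixes g a c :: "'a::{field,finite} poly"
  assumes g: "g \<in> monic_polys i" and ac: "(a, c) \<in> coprime_pairs \<alpha> \<beta>"
    and deg: "\<alpha> + N = \<beta> + L" "\<beta> \<le> N" "h \<le> i + \<alpha> + N"
  shows "card {(b, d) \<in> monic_polys N \<times> monic_polys L. g * a * b - g * c * d \<in> polys_below h}
         = CARD('a) ^ (N - \<beta> + (h - i))"
    (is "card ?S = _")
proof -
  let ?W = "{(x, y) \<in> polys_below N \<times> polys_below L. g * a * x - g * c * y \<in> polys_below h}"
  define s :: "'a poly" where "s = monom 1 (N - \<beta>)"
  have s: "s \<in> monic_polys (N - \<beta>)" unfolding s_def by (rule monom_in_monic_polys)
  have N: "\<beta> + (N - \<beta>) = N" and L: "\<alpha> + (N - \<beta>) = L" using deg by simp_all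
  have "a \<in> monic_polys \<alpha>" "c \<in> monic_polys \<beta>" using ac by (auto simp: coprime_pairs_def)
  then have cs: "c * s \<in> monic_polys N" and as: "a * s \<in> monic_polys L"
    using monic_polys_mult[OF _ s] N L by metis+
  have diff: "g * a * (c * s + x) - g * c * (a * s + y) = g * a * x - g * c * y" for x y
    by (simp add: algebra_simps)
  have "bij_betw (\<lambda>(x, y). (c * s + x, a * s + y)) ?W ?S"
  proof (rule bij_betw_byWitness[where f' = "\<lambda>(b, d). (b - c * s, d - a * s)"])
    show "(\<lambda>(x, y). (c * s + x, a * s + y)) ` ?W \<subseteq> ?S"
      using monic_polys_add_below[OF cs] monic_polys_add_below[OF as] by (auto simp: diff)
    have "(b - c * s, d - a * s) \<in> ?W" if "(b, d) \<in> ?S" for b d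
      using that monic_polys_diff[OF _ cs, of b] monic_polys_diff[OF _ as, of d]
        diff[of "b - c * s" "d - a * s"] by simp
    then show "(\<lambda>(b, d). (b - c * s, d - a * s)) ` ?S \<subseteq> ?W" by auto
  qed auto
  then show ?thesis
    using card_homogeneous_near_solutions[OF assms] by (simp add: bij_betw_same_card)
qed

definition near_quadruples ::
  "nat \<Rightarrow> nat \<Rightarrow> nat \<Rightarrow> nat \<Rightarrow> (('a::field poly \<times> 'a poly) \<times> ('a poly \<times> 'a poly)) set" where
  "near_quadruples n h j k = {((a, b), (c, d)).
     a \<in> monic_polys j \<and> b \<in> monic_polys (n - j) \<and> c \<in> monic_polys k \<and> d \<in> monic_polys (n - k) \<and>
     a * b - c * d \<in> polys_below h}"

text \<open>
  Up to a common factor, the \<open>i\<close>-th term is the contribution of the pairs whose gcd has degree \<open>i\<close>;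
  the factor \<open>1 - 1 / q\<close> is missing for \<open>i = m\<close>, where one of the cofactors is constant. The terms
  with \<open>i < h\<close> telescope, and each \<open>i\<close> with \<open>h \<le> i < m\<close> contributes \<open>1 - 1 / q\<close>.
\<close>
lemma sum_gcd_weights:
  fixes q :: real
  assumes "q \<noteq> 0"
  shows "(\<Sum>i\<le>m. (if i = m then 1 else 1 - 1 / q) * q ^ (h - i)) = q ^ h + (1 - 1 / q) * real (m - h)"
proof -
  have "(\<Sum>i<m. (1 - 1 / q) * q ^ (h - i)) + q ^ (h - m) = q ^ h + (1 - 1 / q) * real (m - h)"
  proof (induction m)
    case (Suc m)
    show ?case
    proof (cases "m < h")
      case True
      then have "q ^ (h - m) = q * q ^ (h - Suc m)"
        by (metis Suc_diff_Suc power_Suc)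
      moreover have "(1 - 1 / q) * (q * y) + y = q * y" for y
        using assms by (simp add: field_simps)
      ultimately show ?thesis using Suc True by (simp add: add.assoc)
    next
      case False
      with Suc show ?thesis by (simp add: algebra_simps Suc_diff_le)
    qed
  qed simp
  then show ?thesis
    by (simp add: lessThan_Suc_atMost[symmetric])
qed

text \<open>
  The condition \<open>j + k \<le> n\<close> guarantees that \<open>b\<close> has degree at least that of \<open>c\<close>, so that the count
  of the pairs \<open>(b, d)\<close> for fixed \<open>(a, c)\<close> depends only on the degree of the gcd of \<open>a\<close> and \<open>c\<close>.
\<close>
lemma card_near_quadruples_balanced:
  assumes jk: "j + k \<le> n" and h: "h \<le> n"
  shows "real (card (near_quadruples n h j k ::
           (('a::{field,finite} poly \<times> 'a poly) \<times> ('a poly \<times> 'a poly)) set))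
    = real CARD('a) ^ (n + h) + (1 - 1 / real CARD('a)) * real CARD('a) ^ n * real (min j k - h)"
proof -
  let ?q = "real CARD('a)"
  define S :: "'a poly \<Rightarrow> 'a poly \<Rightarrow> ('a poly \<times> 'a poly) set" where
    "S a c = {(b, d) \<in> monic_polys (n - j) \<times> monic_polys (n - k). a * b - c * d \<in> polys_below h}" for a c
  have finS: "finite (S a c)" for a c
    unfolding S_def by (rule finite_subset[of _ "monic_polys (n - j) \<times> monic_polys (n - k)"]) auto
  have "bij_betw (\<lambda>((a, c), (b, d)). ((a, b), (c, d)))
          (SIGMA (a, c):monic_polys j \<times> monic_polys k. S a c) (near_quadruples n h j k)"
    by (rule bij_betw_byWitness[where f' = "\<lambda>((a, b), (c, d)). ((a, c), (b, d))"])
      (auto simp: S_def near_quadruples_def)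
  then have "card (near_quadruples n h j k :: (('a poly \<times> 'a poly) \<times> ('a poly \<times> 'a poly)) set)
      = card (SIGMA (a, c):monic_polys j \<times> monic_polys k. S a c)"
    by (rule bij_betw_same_card[symmetric])
  also have "\<dots> = (\<Sum>(a, c)\<in>monic_polys j \<times> monic_polys k. card (S a c))"
    by (subst card_SigmaI) (auto simp: finS split_def)
  also have "real \<dots> = (\<Sum>a\<in>monic_polys j. \<Sum>c\<in>monic_polys k. real (card (S a c)))"
    by (simp add: sum.cartesian_product split_def)
  also have "\<dots> = (\<Sum>i\<le>min j k. ?q ^ i
         * real (card (coprime_pairs (j - i) (k - i) :: ('a poly \<times> 'a poly) set))
         * ?q ^ (n - j - (k - i) + (h - i)))"
  proof (rule sum_monic_pairs_by_gcd)
    fix i and g a c :: "'a poly"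
    assume 1: "i \<le> min j k" "g \<in> monic_polys i" "(a, c) \<in> coprime_pairs (j - i) (k - i)"
    have "card (S (g * a) (g * c)) = CARD('a) ^ (n - j - (k - i) + (h - i))"
      unfolding S_def by (rule card_monic_near_solutions[OF 1(2,3)]) (use 1(1) jk h in auto)
    then show "real (card (S (g * a) (g * c))) = ?q ^ (n - j - (k - i) + (h - i))" by simp
  qed
  also have "\<dots> = (\<Sum>i\<le>min j k. ?q ^ n * ((if i = min j k then 1 else 1 - 1 / ?q) * ?q ^ (h - i)))"
  proof (rule sum.cong[OF refl])
    fix i assume i: "i \<in> {..min j k}"
    have "i + (j - i + (k - i)) + (n - j - (k - i) + (h - i)) = n + (h - i)"
      using i jk by auto
    then have "?q ^ i * ?q ^ (j - i + (k - i)) * ?q ^ (n - j - (k - i) + (h - i)) = ?q ^ n * ?q ^ (h - i)"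
      by (simp flip: power_add)
    moreover have "min (j - i) (k - i) = 0 \<longleftrightarrow> i = min j k" using i by auto
    ultimately show "?q ^ i * real (card (coprime_pairs (j - i) (k - i) :: ('a poly \<times> 'a poly) set))
         * ?q ^ (n - j - (k - i) + (h - i))
       = ?q ^ n * ((if i = min j k then 1 else 1 - 1 / ?q) * ?q ^ (h - i))"
      unfolding card_coprime_pairs by (simp add: mult_ac)
  qed
  also have "\<dots> = ?q ^ n * (?q ^ h + (1 - 1 / ?q) * real (min j k - h))"
    by (subst sum_distrib_left[symmetric], subst sum_gcd_weights) simp_all
  finally show ?thesis by (simp add: power_add algebra_simps)
qed

text \<open>
  If \<open>j + k > n\<close>, exchanging \<open>a\<close> with \<open>b\<close> and \<open>c\<close> with \<open>d\<close> replaces \<open>(j, k)\<close> by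
  \<open>(n - j, n - k)\<close>, whose sum is less than \<open>n\<close>.
\<close>
lemma card_near_quadruples:
  assumes "j \<le> n" "k \<le> n" "h \<le> n"
  shows "real (card (near_quadruples n h j k ::
           (('a::{field,finite} poly \<times> 'a poly) \<times> ('a poly \<times> 'a poly)) set))
    = real CARD('a) ^ (n + h)
      + (1 - 1 / real CARD('a)) * real CARD('a) ^ n * real (min (min j k) (min (n - j) (n - k)) - h)"
proof (cases "j + k \<le> n")
  case True
  then have "min (min j k) (min (n - j) (n - k)) = min j k" by auto
  with card_near_quadruples_balanced[OF True assms(3), where 'a = 'a] show ?thesis by simp
next
  case False
  then have le: "n - j + (n - k) \<le> n" by simp
  have min: "min (min j k) (min (n - j) (n - k)) = min (n - j) (n - k)" using False by auto
  have "bij_betw (\<lambda>((a, b), (c, d)). ((b, a), (d, c)))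
          (near_quadruples n h j k :: (('a poly \<times> 'a poly) \<times> ('a poly \<times> 'a poly)) set)
          (near_quadruples n h (n - j) (n - k))"
    by (rule bij_betw_byWitness[where f' = "\<lambda>((b, a), (d, c)). ((a, b), (c, d))"])
      (use assms in \<open>auto simp: near_quadruples_def mult.commute\<close>)
  then have "card (near_quadruples n h j k :: (('a poly \<times> 'a poly) \<times> ('a poly \<times> 'a poly)) set)
      = card (near_quadruples n h (n - j) (n - k) :: (('a poly \<times> 'a poly) \<times> ('a poly \<times> 'a poly)) set)"
    by (rule bij_betw_same_card)
  with card_near_quadruples_balanced[OF le assms(3), where 'a = 'a] min show ?thesis by simp
qed

section \<open>The correlation sum of the divisor function\<close>

definition factor_pairs :: "nat \<Rightarrow> ('a::field poly \<times> 'a poly) set" where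
  "factor_pairs n = (\<Union>j\<le>n. monic_polys j \<times> monic_polys (n - j))"

lemma finite_factor_pairs [simp]: "finite (factor_pairs n :: ('a::{field,finite} poly \<times> 'a poly) set)"
  by (simp add: factor_pairs_def)

lemma factor_pairs_mult: "x \<in> factor_pairs n \<Longrightarrow> fst x * snd x \<in> monic_polys n"
  using monic_polys_mult[of "fst x" _ "snd x"] by (fastforce simp: factor_pairs_def)

lemma divisor_count_eq_sum:
  fixes A :: "'a::{field,finite} poly"
  assumes "A \<in> monic_polys n"
  shows "real (divisor_count A) = (\<Sum>x\<in>factor_pairs n. of_bool (A = fst x * snd x))"
proof -
  have "{(A1, A2). lead_coeff A1 = 1 \<and> lead_coeff A2 = 1 \<and> A1 * A2 = A}
      = {x \<in> factor_pairs n. A = fst x * snd x}" (is "?L = ?R")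
  proof (intro equalityI subsetI)
    fix x assume "x \<in> ?L"
    then have *: "lead_coeff (fst x) = 1" "lead_coeff (snd x) = 1" "fst x * snd x = A" by auto
    then have 1: "fst x \<in> monic_polys (degree (fst x))" by (simp add: monic_polys_def)
    have "degree (fst x) \<le> n" "snd x \<in> monic_polys (n - degree (fst x))"
      using monic_polys_cancel_left[OF 1] *(3) assms by auto
    with 1 *(3) show "x \<in> ?R"
      by (cases x) (auto simp: factor_pairs_def)
  next
    fix x assume "x \<in> ?R"
    then show "x \<in> ?L" by (auto simp: factor_pairs_def monic_polys_def)
  qed
  then show ?thesis
    by (simp add: divisor_count_def of_bool_def sum.If_cases Int_def)
qed

lemma sum_divisor_count:
  fixes f :: "'a::{field,finite} poly \<Rightarrow> real"
  shows "(\<Sum>A\<in>monic_polys n. real (divisor_count A) * f A) = (\<Sum>x\<in>factor_pairs n. f (fst x * snd x))"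
proof -
  have "(\<Sum>A\<in>monic_polys n. real (divisor_count A) * f A)
      = (\<Sum>A\<in>monic_polys n. \<Sum>x\<in>factor_pairs n. of_bool (A = fst x * snd x) * f A)"
    by (simp add: divisor_count_eq_sum sum_distrib_right del: sum_of_bool_mult_eq sum_mult_of_bool_eq sum_of_bool_eq)
  also have "\<dots> = (\<Sum>x\<in>factor_pairs n. \<Sum>A\<in>monic_polys n. of_bool (A = fst x * snd x) * f A)"
    by (rule sum.swap)
  also have "\<dots> = (\<Sum>x\<in>factor_pairs n. f (fst x * snd x))"
  proof (rule sum.cong[OF refl])
    fix x :: "'a poly \<times> 'a poly" assume "x \<in> factor_pairs n"
    then have "fst x * snd x \<in> monic_polys n" by (rule factor_pairs_mult)
    then show "(\<Sum>A\<in>monic_polys n. of_bool (A = fst x * snd x) * f A) = f (fst x * snd x)"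
      by (simp add: of_bool_def if_distrib[of "\<lambda>t. t * _"] sum.delta cong: if_cong)
  qed
  finally show ?thesis .
qed

lemma sum_factor_pairs:
  "(\<Sum>x\<in>factor_pairs n. f x) = (\<Sum>j\<le>n. \<Sum>x\<in>monic_polys j \<times> monic_polys (n - j).
      (f :: ('a::{field,finite} poly \<times> 'a poly) \<Rightarrow> real) x)"
  unfolding factor_pairs_def
  by (rule sum.UNION_disjoint) (auto dest: monic_polys_degree)

lemma card_factor_pairs:
  "real (card (factor_pairs n :: ('a::{field,finite} poly \<times> 'a poly) set)) = real CARD('a) ^ n * (real n + 1)"
  using sum_factor_pairs[of "\<lambda>_::'a poly \<times> 'a poly. 1" n]
  by (simp add: card_cartesian_product card_monic_polys mult.commute flip: power_add)

lemma bij_betw_add_interval: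
  assumes "A \<in> monic_polys n" "h \<le> n"
  shows "bij_betw ((+) A) (polys_below h) {C \<in> monic_polys n. A - C \<in> polys_below h}"
proof (rule bij_betw_byWitness[where f' = "\<lambda>C. C - A"])
  show "(+) A ` polys_below h \<subseteq> {C \<in> monic_polys n. A - C \<in> polys_below h}"
    using monic_polys_add_below[OF assms(1)] polys_below_mono[OF _ assms(2)] by auto
  have "C - A \<in> polys_below h" if "A - C \<in> polys_below h" for C
    using polys_below_uminus_iff[of "A - C" h] that by simp
  then show "(\<lambda>C. C - A) ` {C \<in> monic_polys n. A - C \<in> polys_below h} \<subseteq> polys_below h" by auto
qed auto

lemma divisor_correlation_eq_count:
  assumes "h \<le> n"
  shows "(\<Sum>A\<in>(monic_polys n :: 'a::{field,finite} poly set). \<Sum>B\<in>polys_below h.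
            real (divisor_count A) * real (divisor_count (A + B)))
    = (\<Sum>j\<le>n. \<Sum>k\<le>n. real (card (near_quadruples n h j k ::
          (('a poly \<times> 'a poly) \<times> ('a poly \<times> 'a poly)) set)))"
proof -
  let ?p = "\<lambda>x :: 'a poly \<times> 'a poly. fst x * snd x"
  let ?near = "\<lambda>A C :: 'a poly. of_bool (A - C \<in> polys_below h) :: real"
  have inner: "(\<Sum>B\<in>polys_below h. real (divisor_count (A + B))) = (\<Sum>y\<in>factor_pairs n. ?near A (?p y))"
    if A: "A \<in> monic_polys n" for A :: "'a poly"
  proof -
    have "(\<Sum>B\<in>polys_below h. real (divisor_count (A + B)))
        = (\<Sum>C\<in>{C \<in> monic_polys n. A - C \<in> polys_below h}. real (divisor_count C))"
      by (rule sum.reindex_bij_betw[OF bij_betw_add_interval[OF A assms]])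
    also have "\<dots> = (\<Sum>C\<in>monic_polys n. real (divisor_count C) * ?near A C)"
      by (simp add: sum.inter_filter of_bool_def if_distrib[of "\<lambda>t. _ * t"] cong: if_cong)
    finally show ?thesis by (simp only: sum_divisor_count)
  qed
  have "(\<Sum>A\<in>(monic_polys n :: 'a poly set). \<Sum>B\<in>polys_below h.
            real (divisor_count A) * real (divisor_count (A + B)))
      = (\<Sum>A\<in>monic_polys n. real (divisor_count A) * (\<Sum>y\<in>factor_pairs n. ?near A (?p y)))"
    by (simp add: inner flip: sum_distrib_left)
  also have "\<dots> = (\<Sum>x\<in>factor_pairs n. \<Sum>y\<in>factor_pairs n. ?near (?p x) (?p y))"
    by (rule sum_divisor_count)
  also have "\<dots> = (\<Sum>j\<le>n. \<Sum>x\<in>monic_polys j \<times> monic_polys (n - j).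
                     \<Sum>k\<le>n. \<Sum>y\<in>monic_polys k \<times> monic_polys (n - k). ?near (?p x) (?p y))"
    by (simp only: sum_factor_pairs)
  also have "\<dots> = (\<Sum>j\<le>n. \<Sum>k\<le>n. \<Sum>x\<in>monic_polys j \<times> monic_polys (n - j).
                     \<Sum>y\<in>monic_polys k \<times> monic_polys (n - k). ?near (?p x) (?p y))"
    by (intro sum.cong refl sum.swap)
  also have "\<dots> = (\<Sum>j\<le>n. \<Sum>k\<le>n. real (card (near_quadruples n h j k ::
          (('a poly \<times> 'a poly) \<times> ('a poly \<times> 'a poly)) set)))"
  proof (intro sum.cong refl)
    fix j k
    let ?X = "(monic_polys j \<times> monic_polys (n - j)) \<times> (monic_polys k \<times> monic_polys (n - k)) ::
        (('a poly \<times> 'a poly) \<times> ('a poly \<times> 'a poly)) set"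
    have "(\<Sum>x\<in>monic_polys j \<times> monic_polys (n - j). \<Sum>y\<in>monic_polys k \<times> monic_polys (n - k). ?near (?p x) (?p y))
        = (\<Sum>z\<in>?X. if z \<in> near_quadruples n h j k then 1 else 0)"
      unfolding sum.cartesian_product
      by (rule sum.cong) (auto simp: near_quadruples_def)
    also have "\<dots> = real (card (?X \<inter> near_quadruples n h j k))"
      by (simp add: sum.If_cases)
    also have "?X \<inter> near_quadruples n h j k = near_quadruples n h j k"
      by (auto simp: near_quadruples_def)
    finally show "(\<Sum>x\<in>monic_polys j \<times> monic_polys (n - j). \<Sum>y\<in>monic_polys k \<times> monic_polys (n - k). ?near (?p x) (?p y))
        = real (card (near_quadruples n h j k :: (('a poly \<times> 'a poly) \<times> ('a poly \<times> 'a poly)) set))" .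
  qed
  finally show ?thesis .
qed

text \<open>
  Lowering \<open>h + 1\<close> to \<open>h\<close> raises the term at \<open>(j, k)\<close> by one exactly when \<open>j\<close> and \<open>k\<close> both lie
  between \<open>h + 1\<close> and \<open>n - h - 1\<close>, that is, for \<open>(n - 2 * h - 1)\<^sup>2\<close> pairs. Summing these squares
  downwards from \<open>h = n div 2\<close>, where everything vanishes, gives the cubic polynomial.
\<close>
lemma sum_min_excess:
  "(\<Sum>j\<le>n. \<Sum>k\<le>n. real (min (min j k) (min (n - j) (n - k)) - h))
   = (if h \<le> n div 2 then (real n - 2 * real h - 1) * (real n - 2 * real h) * (real n - 2 * real h + 1) / 6 else 0)"
proof -
  define G where "G h = (\<Sum>j\<le>n. \<Sum>k\<le>n. real (min (min j k) (min (n - j) (n - k)) - h))" for h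
  define R where "R h = (real n - 2 * real h - 1) * (real n - 2 * real h) * (real n - 2 * real h + 1) / 6" for h
  have zero: "G h = 0" if "h \<ge> n div 2" for h
    unfolding G_def using that by (intro sum.neutral ballI) auto
  have base: "R (n div 2) = 0"
    unfolding R_def by (cases "even n") (auto elim!: evenE oddE)
  have step: "G h = G (Suc h) + (real n - 2 * real h - 1)\<^sup>2" if h: "h < n div 2" for h
  proof -
    let ?J = "{Suc h..n - Suc h}"
    have "G h - G (Suc h) = (\<Sum>j\<le>n. \<Sum>k\<le>n. of_bool (j \<in> ?J) * of_bool (k \<in> ?J))"
      unfolding G_def sum_subtractf[symmetric]
    proof (intro sum.cong refl)
      fix j k assume "j \<in> {..n}" "k \<in> {..n}"
      let ?m = "min (min j k) (min (n - j) (n - k))"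
      have "real (?m - h) - real (?m - Suc h) = of_bool (h < ?m)" by auto
      also have "h < ?m \<longleftrightarrow> j \<in> ?J \<and> k \<in> ?J"
        using \<open>j \<in> {..n}\<close> \<open>k \<in> {..n}\<close> by auto
      finally show "real (?m - h) - real (?m - Suc h) = of_bool (j \<in> ?J) * of_bool (k \<in> ?J)"
        by simp
    qed
    also have "\<dots> = (\<Sum>j\<le>n. of_bool (j \<in> ?J))\<^sup>2"
      by (simp only: power2_eq_square sum_product)
    also have "(\<Sum>j\<le>n. of_bool (j \<in> ?J)) = real (card ({..n} \<inter> ?J))"
      by (simp add: of_bool_def sum.If_cases Int_def)
    also have "{..n} \<inter> ?J = ?J" by auto
    also have "real (card ?J) = real n - 2 * real h - 1" using h by (simp add: of_nat_diff)
    finally show ?thesis by simp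
  qed
  have main: "G h = R h" if "h \<le> n div 2" for h
    using that
  proof (induction rule: inc_induct)
    case base
    show ?case using zero[of "n div 2"] \<open>R (n div 2) = 0\<close> by simp
  next
    case (step h)
    have "R h = R (Suc h) + (real n - 2 * real h - 1)\<^sup>2"
      by (simp add: R_def power2_eq_square field_simps)
    with step \<open>\<And>h. h < n div 2 \<Longrightarrow> G h = G (Suc h) + (real n - 2 * real h - 1)\<^sup>2\<close> show ?case by simp
  qed
  show ?thesis using main[of h] zero[of h] by (simp add: G_def R_def)
qed

lemma divisor_correlation:
  assumes "h \<le> n"
  shows "(\<Sum>A\<in>(monic_polys n :: 'a::{field,finite} poly set). \<Sum>B\<in>polys_below h.
            real (divisor_count A) * real (divisor_count (A + B)))
    = real CARD('a) ^ (n + h) * (real n + 1)\<^sup>2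
      + (1 - 1 / real CARD('a)) * real CARD('a) ^ n *
        (if h \<le> n div 2 then (real n - 2 * real h - 1) * (real n - 2 * real h) * (real n - 2 * real h + 1) / 6 else 0)"
proof -
  have "(\<Sum>A\<in>(monic_polys n :: 'a poly set). \<Sum>B\<in>polys_below h.
            real (divisor_count A) * real (divisor_count (A + B)))
    = (\<Sum>j\<le>n. \<Sum>k\<le>n. real CARD('a) ^ (n + h)
        + (1 - 1 / real CARD('a)) * real CARD('a) ^ n * real (min (min j k) (min (n - j) (n - k)) - h))"
    unfolding divisor_correlation_eq_count[OF assms]
    by (intro sum.cong refl card_near_quadruples) (use assms in auto)
  also have "\<dots> = real CARD('a) ^ (n + h) * (real n + 1)\<^sup>2
      + (1 - 1 / real CARD('a)) * real CARD('a) ^ n *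
        (\<Sum>j\<le>n. \<Sum>k\<le>n. real (min (min j k) (min (n - j) (n - k)) - h))"
    unfolding sum.distrib sum_distrib_left[symmetric] by (simp add: power2_eq_square algebra_simps)
  finally show ?thesis unfolding sum_min_excess .
qed

section \<open>Second moment over short intervals\<close>

definition interval_sum :: "nat \<Rightarrow> 'a::field poly \<Rightarrow> real" where
  "interval_sum h A = (\<Sum>B\<in>polys_below h. real (divisor_count (A + B)))"

lemma sum_short_interval:
  assumes "A \<in> monic_polys n" "h \<le> n"
  shows "(\<Sum>B\<in>short_interval A h. real (divisor_count B)) = interval_sum h A"
proof -
  have "short_interval A h = {C \<in> monic_polys n. A - C \<in> polys_below h}" (is "_ = ?R")
  proof (intro equalityI subsetI)
    fix C assume "C \<in> short_interval A h"
    then have C: "lead_coeff C = 1" "C - A \<in> polys_below h" by (auto simp: short_interval_def)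
    have "A + (C - A) \<in> monic_polys n"
      using assms C by (intro monic_polys_add_below polys_below_mono[of _ h n])
    then show "C \<in> ?R" using C(2) polys_below_uminus_iff[of "C - A" h] by simp
  next
    fix C assume "C \<in> ?R"
    then show "C \<in> short_interval A h"
      using polys_below_uminus_iff[of "A - C" h] by (auto simp: short_interval_def monic_polys_def)
  qed
  then show ?thesis
    using sum.reindex_bij_betw[OF bij_betw_add_interval[OF assms], of "\<lambda>C. real (divisor_count C)"]
    by (simp add: interval_sum_def)
qed

lemma bij_betw_translate_polys_below:
  assumes "B \<in> polys_below h"
  shows "bij_betw ((+) B) (polys_below h) (polys_below h)"
  by (rule bij_betw_byWitness[where f' = "\<lambda>C. C - B"])
    (use assms in \<open>auto intro: polys_below_add polys_below_diff\<close>)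

lemma interval_sum_translate:
  assumes "B \<in> polys_below h"
  shows "interval_sum h (A + B) = interval_sum h A"
  using sum.reindex_bij_betw[OF bij_betw_translate_polys_below[OF assms], of "\<lambda>C. real (divisor_count (A + C))"]
  by (simp add: interval_sum_def add.assoc)

lemma sum_monic_translate:
  assumes "B \<in> polys_below n"
  shows "(\<Sum>A\<in>monic_polys n. f (A + B)) = (\<Sum>A\<in>monic_polys n. (f :: 'a::field poly \<Rightarrow> real) A)"
  by (rule sum.reindex_bij_witness[of _ "\<lambda>A. A - B" "\<lambda>A. A + B"])
    (use assms in \<open>auto intro: monic_polys_add_below monic_polys_diff_below\<close>)

text \<open>
  Averaging over translates: shifting \<open>A\<close> by \<open>B\<close> permutes the monic polynomials of degree \<open>n\<close>
  and does not change \<open>f\<close>.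
\<close>
lemma sum_interval_sum_mult:
  fixes f :: "'a::{field,finite} poly \<Rightarrow> real"
  assumes "h \<le> n" and inv: "\<And>A B. B \<in> polys_below h \<Longrightarrow> f (A + B) = f A"
  shows "(\<Sum>A\<in>monic_polys n. interval_sum h A * f A)
    = real CARD('a) ^ h * (\<Sum>A\<in>monic_polys n. real (divisor_count A) * f A)"
proof -
  have "(\<Sum>A\<in>monic_polys n. interval_sum h A * f A)
      = (\<Sum>A\<in>monic_polys n. \<Sum>B\<in>polys_below h. real (divisor_count (A + B)) * f (A + B))"
    by (simp add: interval_sum_def sum_distrib_right inv)
  also have "\<dots> = (\<Sum>B\<in>polys_below h. \<Sum>A\<in>monic_polys n. real (divisor_count (A + B)) * f (A + B))"
    by (rule sum.swap)
  also have "\<dots> = (\<Sum>B\<in>(polys_below h :: 'a poly set). \<Sum>A\<in>monic_polys n. real (divisor_count A) * f A)"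
    by (intro sum.cong refl sum_monic_translate[of _ n "\<lambda>A. real (divisor_count A) * f A"]
        polys_below_mono[OF _ assms(1)])
  finally show ?thesis by (simp add: card_polys_below)
qed

text \<open>
  With \<open>m = q ^ h * (n + 1)\<close>, the error is \<open>interval_sum h A - m\<close>. Since \<open>m\<close> is the mean of
  the interval sums, the second moment about it is the plain second moment minus \<open>m\<^sup>2\<close>; and since
  the interval sum is invariant under translation by \<open>polys_below h\<close>, its second moment is
  \<open>q ^ h\<close> times the correlation sum.
\<close>
lemma sum_divisor_error_square:
  assumes h: "h \<le> n"
  shows "(\<Sum>A\<in>(monic_polys n :: 'a::{field,finite} poly set). \<bar>divisor_error A h\<bar>\<^sup>2)
    = real CARD('a) ^ h * (\<Sum>A\<in>(monic_polys n :: 'a poly set). \<Sum>B\<in>polys_below h.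
          real (divisor_count A) * real (divisor_count (A + B)))
      - real CARD('a) ^ (2 * h + n) * (real n + 1)\<^sup>2"
proof -
  let ?M = "monic_polys n :: 'a poly set"
  let ?V = "\<Sum>A\<in>?M. \<Sum>B\<in>polys_below h. real (divisor_count A) * real (divisor_count (A + B))"
  define m where "m = real CARD('a) ^ h * (real n + 1)"
  have sq: "(\<Sum>A\<in>?M. interval_sum h A * interval_sum h A) = real CARD('a) ^ h * ?V"
    by (subst sum_interval_sum_mult[OF h interval_sum_translate])
      (simp_all add: interval_sum_def sum_distrib_left)
  have lin: "(\<Sum>A\<in>?M. interval_sum h A) = real CARD('a) ^ n * m"
    using sum_interval_sum_mult[OF h, of "\<lambda>_::'a poly. 1"] sum_divisor_count[of "\<lambda>_::'a poly. 1" n]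
    by (simp add: card_factor_pairs m_def)
  have "(\<Sum>A\<in>?M. \<bar>divisor_error A h\<bar>\<^sup>2) = (\<Sum>A\<in>?M. (interval_sum h A - m)\<^sup>2)"
    by (intro sum.cong refl)
      (simp add: divisor_error_def sum_short_interval[OF _ h] monic_polys_degree m_def)
  also have "\<dots> = (\<Sum>A\<in>?M. interval_sum h A * interval_sum h A) - 2 * m * (\<Sum>A\<in>?M. interval_sum h A)
                  + (\<Sum>A\<in>?M. m\<^sup>2)"
    by (simp add: power2_diff power2_eq_square sum.distrib sum_subtractf sum_distrib_left algebra_simps)
  also have "\<dots> = real CARD('a) ^ h * ?V - real CARD('a) ^ n * m\<^sup>2"
    unfolding sq lin by (simp add: card_monic_polys power2_eq_square algebra_simps)
  also have "real CARD('a) ^ n * m\<^sup>2 = real CARD('a) ^ (2 * h + n) * (real n + 1)\<^sup>2"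
    unfolding m_def power_mult_distrib by (simp add: power_add power_mult mult.commute[of 2 h] mult_ac)
  finally show ?thesis .
qed

theorem theorem1p2p2:
  fixes q n h :: nat
  assumes q: "q = CARD('a::{field,finite})"
    and n: "n \<ge> 4"
    and h: "h \<le> n"
  shows
    "(1 / real q ^ (h + n)) *
       (\<Sum>A\<in>(monic_polys n :: 'a poly set). \<Sum>B\<in>polys_below h.
          real (divisor_count A) * real (divisor_count (A + B)))
     = (real n + 1)\<^sup>2 +
       (1 / real q ^ (2 * h + n)) *
         (\<Sum>A\<in>(monic_polys n :: 'a poly set). \<bar>divisor_error A h\<bar>\<^sup>2)
     \<and>
     (1 / real q ^ (h + n)) *
       (\<Sum>A\<in>(monic_polys n :: 'a poly set). \<Sum>B\<in>polys_below h.
          real (divisor_count A) * real (divisor_count (A + B)))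
     = (if h \<le> n div 2 - 1
        then (real n + 1)\<^sup>2 +
             (1 - 1 / real q) * (1 / real q ^ h) *
             ((real n - 2 * real h - 1) * (real n - 2 * real h) * (real n - 2 * real h + 1) / 6)
        else (real n + 1)\<^sup>2)"
proof -
  define V where "V = (\<Sum>A\<in>(monic_polys n :: 'a poly set). \<Sum>B\<in>polys_below h.
          real (divisor_count A) * real (divisor_count (A + B)))"
  define D where "D = (\<Sum>A\<in>(monic_polys n :: 'a poly set). \<bar>divisor_error A h\<bar>\<^sup>2)"
  define Q where "Q = (real n - 2 * real h - 1) * (real n - 2 * real h) * (real n - 2 * real h + 1) / 6"
  have q0: "real q \<noteq> 0" by (simp add: q)
  have "D = real q ^ h * V - real q ^ (2 * h + n) * (real n + 1)\<^sup>2"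
    unfolding D_def V_def q by (rule sum_divisor_error_square[OF h])
  moreover have "real q ^ (2 * h + n) = real q ^ h * real q ^ (h + n)"
    by (simp add: mult_2 add.assoc flip: power_add)
  ultimately have "1 / real q ^ (h + n) * V = (real n + 1)\<^sup>2 + 1 / real q ^ (2 * h + n) * D"
    using q0 by (simp add: diff_divide_distrib)
  moreover have "V = real q ^ (n + h) * (real n + 1)\<^sup>2
      + (1 - 1 / real q) * real q ^ n * (if h \<le> n div 2 then Q else 0)"
    unfolding V_def q Q_def by (rule divisor_correlation[OF h])
  then have "1 / real q ^ (h + n) * V = (real n + 1)\<^sup>2
      + (1 - 1 / real q) * (1 / real q ^ h) * (if h \<le> n div 2 then Q else 0)"
    using q0 by (simp add: add_divide_distrib power_add)
  \<comment> \<open>At \<open>h = n div 2\<close> the cubic vanishes, as \<open>n - 2 * h\<close> is \<open>0\<close> or \<open>1\<close>, so the threshold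
    can be lowered to \<open>n div 2 - 1\<close>.\<close>
  moreover have "Q = 0" if "h = n div 2"
    unfolding Q_def that by (cases "even n") (auto elim!: evenE oddE)
  moreover have "h \<le> n div 2 \<longleftrightarrow> h \<le> n div 2 - 1 \<or> h = n div 2"
    using n by linarith
  ultimately show ?thesis
    unfolding V_def[symmetric] D_def[symmetric] Q_def[symmetric] by auto
qed

end
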